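(* $MC(F_4)=6$.
   Context: Let $\Delta$ be a finite irreducible crystallographic root system with a fixed positive system $\Delta^+$ and Weyl group $W$. For $w\in W$ set $N(w)=\{\alpha\in\Delta^+\mid w^{-1}(\alpha)\in-\Delta^+\}$. A subset $Y\subset W$ is inversion complete if $\bigcup_{w\in Y}N(w)=\Delta^+$; it is minimal inversion complete if it is inversion complete and no proper subset of $Y$ is inversion complete. If $\Delta$ is of type $T$, $MC(T)$ denotes the maximal cardinality of a minimal inversion complete subset of $W$. *)

theory Defs
  imports "HOL-Analysis.Analysis" "HOL-Algebra.Bij" "HOL-Algebra.Generated_Groups"
begin

definition cartan_integer :: "'a::real_inner \<Rightarrow> 'a \<Rightarrow> real" where
  "cartan_integer \<beta> \<alpha> = 2 * (\<beta> \<bullet> \<alpha>) / (\<alpha> \<bullet> \<alpha>)"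

definition reflection :: "'a::real_inner \<Rightarrow> 'a \<Rightarrow> 'a" where
  "reflection \<alpha> x = x - cartan_integer x \<alpha> *\<^sub>R \<alpha>"

(* Root systems are reduced and span the ambient Euclidean space, whose dimension is
   therefore the rank. *)
definition root_system :: "'a::euclidean_space set \<Rightarrow> bool" where
  "root_system \<Delta> \<longleftrightarrow>
     finite \<Delta> \<and> 0 \<notin> \<Delta> \<and> span \<Delta> = UNIV \<and>
     (\<forall>\<alpha>\<in>\<Delta>. reflection \<alpha> ` \<Delta> = \<Delta>) \<and>
     (\<forall>\<alpha>\<in>\<Delta>. \<Delta> \<inter> span {\<alpha>} = {\<alpha>, - \<alpha>})"

definition crystallographic :: "'a::euclidean_space set \<Rightarrow> bool" where
  "crystallographic \<Delta> \<longleftrightarrow> (\<forall>\<alpha>\<in>\<Delta>. \<forall>\<beta>\<in>\<Delta>. cartan_integer \<beta> \<alpha> \<in> \<int>)"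

definition irreducible_roots :: "'a::euclidean_space set \<Rightarrow> bool" where
  "irreducible_roots \<Delta> \<longleftrightarrow>
     \<Delta> \<noteq> {} \<and>
     \<not> (\<exists>A B. A \<noteq> {} \<and> B \<noteq> {} \<and> A \<inter> B = {} \<and> A \<union> B = \<Delta> \<and>
             (\<forall>\<alpha>\<in>A. \<forall>\<beta>\<in>B. \<alpha> \<bullet> \<beta> = 0))"

(* The positive roots with respect to a vector lying on no reflecting hyperplane. *)
definition positive_system :: "'a::euclidean_space set \<Rightarrow> 'a set \<Rightarrow> bool" where
  "positive_system \<Delta> P \<longleftrightarrow>
     (\<exists>\<rho>. (\<forall>\<alpha>\<in>\<Delta>. \<rho> \<bullet> \<alpha> \<noteq> 0) \<and> P = {\<alpha>\<in>\<Delta>. \<rho> \<bullet> \<alpha> > 0})"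

definition simple_roots :: "'a::euclidean_space set \<Rightarrow> 'a set" where
  "simple_roots P = {\<alpha>\<in>P. \<not> (\<exists>\<beta>\<in>P. \<exists>\<gamma>\<in>P. \<alpha> = \<beta> + \<gamma>)}"

(* C is a square matrix given by its list of rows; P is the positive system. *)
definition has_cartan_matrix :: "'a::euclidean_space set \<Rightarrow> int list list \<Rightarrow> bool" where
  "has_cartan_matrix P C \<longleftrightarrow>
     (\<exists>as. distinct as \<and> set as = simple_roots P \<and> length as = length C \<and>
        (\<forall>i<length C. \<forall>j<length C.
           cartan_integer (as ! i) (as ! j) = of_int (C ! i ! j)))"

definition F4 :: "int list list" where
  "F4 = [[ 2, -1,  0,  0],
         [-1,  2, -2,  0],
         [ 0, -1,  2, -1],
         [ 0,  0, -1,  2]]"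

definition weyl_group :: "'a::euclidean_space set \<Rightarrow> ('a \<Rightarrow> 'a) set" where
  "weyl_group \<Delta> = generate (BijGroup UNIV) (reflection ` \<Delta>)"

(* inv_into UNIV w is the inverse function; the short form clashes with the
   group-inverse notation of HOL-Algebra. *)
definition inversions :: "'a::euclidean_space set \<Rightarrow> ('a \<Rightarrow> 'a) \<Rightarrow> 'a set" where
  "inversions P w = {\<alpha>\<in>P. inv_into UNIV w \<alpha> \<in> uminus ` P}"

definition inversion_complete :: "'a::euclidean_space set \<Rightarrow> ('a \<Rightarrow> 'a) set \<Rightarrow> bool" where
  "inversion_complete P Y \<longleftrightarrow> (\<Union>w\<in>Y. inversions P w) = P"

definition minimal_inversion_complete ::
    "'a::euclidean_space set \<Rightarrow> ('a \<Rightarrow> 'a) set \<Rightarrow> bool" where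
  "minimal_inversion_complete P Y \<longleftrightarrow>
     inversion_complete P Y \<and> (\<forall>Z. Z \<subset> Y \<longrightarrow> \<not> inversion_complete P Z)"

(* For a root system the Weyl group is finite, so Max ranges over a finite set. *)
definition MC :: "'a::euclidean_space set \<Rightarrow> 'a set \<Rightarrow> nat" where
  "MC \<Delta> P = Max {card Y | Y. Y \<subseteq> weyl_group \<Delta> \<and> minimal_inversion_complete P Y}"

end

theory Submission
  imports Defs
begin

text \<open>In a minimal inversion complete set \<open>Y\<close> each \<open>w\<close> has a private root, inverted by no other element
of \<open>Y\<close>. The functional \<open>\<lambda>x. \<rho> \<bullet> w\<^sup>-\<^sup>1 x\<close> is negative on the private root of \<open>w\<close> and positive on the set
of all other private roots, hence on the cone they span. As every positive root is inverted by some
\<open>w\<close>, the set \<open>A\<close> of private roots has the property that no positive root lies in all of the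
cones spanned by \<open>A - {\<alpha>}\<close> with \<open>\<alpha> \<in> A\<close>. This property is inherited by subsets, and a search
through the subsets of the 24 positive roots of \<open>F\<^sub>4\<close> shows that it forces \<open>card A \<le> 6\<close>. To violate the property it mostly
suffices to find disjoint subsets of \<open>A\<close> whose cones contain a common positive root. Conversely, six
products of two reflections form a minimal inversion complete set.\<close>

section \<open>Sets of positive roots of type F4\<close>

type_synonym vec = "int \<times> int \<times> int \<times> int"

text \<open>Coordinates of the positive roots with respect to the simple roots, in the order of the Cartan
matrix.\<close>

definition pos_roots :: "vec list" where
  "pos_roots = [
    (0, 0, 0, 1), (0, 0, 1, 0), (0, 1, 0, 0), (1, 0, 0, 0), (0, 0, 1, 1), (0, 1, 1, 0),
    (1, 1, 0, 0), (0, 1, 1, 1), (0, 1, 2, 0), (1, 1, 1, 0), (0, 1, 2, 1), (1, 1, 1, 1),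
    (1, 1, 2, 0), (0, 1, 2, 2), (1, 1, 2, 1), (1, 2, 2, 0), (1, 1, 2, 2), (1, 2, 2, 1),
    (1, 2, 2, 2), (1, 2, 3, 1), (1, 2, 3, 2), (1, 2, 4, 2), (1, 3, 4, 2), (2, 3, 4, 2)]"

text \<open>The entry at position \<open>i\<close> lists the pairs of positive roots, given by their positions in
\<open>pos_roots\<close>, that have root \<open>i\<close> in the interior of the cone they span.\<close>

definition rank2 :: "(nat \<times> nat) list list" where
  "rank2 = [
     [],
     [],
     [],
     [],
     [(0, 1)],
     [(1, 2), (2, 8)],
     [(2, 3)],
     [(0, 5), (2, 4), (2, 13)],
     [(1, 2), (1, 5)],
     [(1, 6), (3, 5), (3, 15), (6, 12)],
     [(0, 8), (1, 7), (4, 5), (8, 13)],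
     [(0, 9), (3, 7), (3, 18), (4, 6), (6, 16)],
     [(1, 6), (1, 9), (3, 8)],
     [(0, 8), (0, 10), (2, 4), (4, 7)],
     [(0, 12), (1, 11), (3, 10), (3, 21), (4, 9), (12, 16)],
     [(2, 12), (3, 5), (5, 9), (6, 8)],
     [(0, 12), (0, 14), (3, 13), (4, 6), (4, 11)],
     [(0, 15), (2, 14), (2, 23), (5, 11), (6, 10), (6, 22), (7, 9), (15, 18)],
     [(0, 15), (0, 17), (2, 16), (3, 7), (6, 13), (7, 11)],
     [(1, 17), (4, 15), (5, 14), (7, 12), (8, 11), (8, 23), (9, 10), (12, 22), (15, 21)],
     [(0, 19), (1, 18), (4, 17), (5, 16), (7, 14), (9, 13), (10, 11), (13, 23), (16, 22),
     (18, 21)],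
     [(1, 18), (1, 20), (3, 10), (4, 15), (4, 19), (8, 16), (10, 14), (12, 13)],
     [(2, 21), (5, 16), (5, 20), (6, 10), (7, 12), (7, 19), (8, 18), (10, 17), (13, 15)],
     [(2, 14), (3, 22), (6, 21), (8, 11), (9, 13), (9, 20), (11, 19), (12, 18), (14, 17),
     (15, 16)]]"

text \<open>A pair \<open>(i, is)\<close> means that for every \<open>j\<close> in \<open>is\<close> root \<open>i\<close> is a positive combination of the roots
in \<open>is\<close> other than \<open>j\<close>. Here three triples within \<open>is\<close> represent root \<open>i\<close> and have empty common
intersection, though no two of them are disjoint.\<close>

definition triads :: "(nat \<times> nat list) list" where
  "triads = [
    (17, [2, 5, 6, 9, 18, 20]), (17, [2, 6, 7, 11, 15, 19]), (19, [1, 5, 9, 21, 22, 23]),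
    (19, [1, 5, 12, 15, 20, 23]), (19, [1, 8, 9, 15, 20, 22]), (19, [5, 8, 9, 12, 20, 21]),
    (19, [8, 10, 12, 14, 15, 17]), (20, [0, 10, 14, 18, 22, 23]),
    (20, [0, 10, 16, 17, 21, 23]), (20, [0, 13, 14, 17, 21, 22]), (20, [4, 7, 11, 21, 22, 23]),
    (20, [4, 7, 16, 18, 19, 23]), (20, [4, 11, 13, 18, 19, 22]), (20, [7, 11, 13, 16, 19, 21]),
    (20, [10, 13, 14, 16, 17, 18]), (21, [1, 4, 8, 13, 14, 23]), (21, [1, 4, 10, 12, 16, 22]),
    (22, [2, 5, 10, 13, 19, 23]), (22, [2, 7, 8, 10, 20, 23]), (22, [2, 8, 13, 17, 19, 20]),
    (22, [5, 7, 8, 13, 17, 23]), (22, [5, 7, 10, 15, 18, 21]), (23, [3, 9, 17, 18, 19, 21]),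
    (23, [3, 11, 15, 17, 20, 21]), (23, [3, 14, 15, 18, 19, 20]), (23, [6, 9, 14, 16, 19, 22]),
    (23, [6, 11, 12, 14, 20, 22]), (23, [6, 12, 16, 17, 19, 20]),
    (23, [9, 11, 12, 16, 17, 22]), (23, [9, 11, 14, 15, 18, 21])]"

text \<open>Monotone Boolean functions of a subset \<open>A\<close> of a list, as decision diagrams with one level per list
element. In \<open>Node h l\<close> the branch \<open>l\<close> applies whether or not the element is in \<open>A\<close>.\<close>

datatype mbf = Top | Bot | Node mbf mbf

fun sat :: "mbf \<Rightarrow> 'a list \<Rightarrow> 'a set \<Rightarrow> bool" where
  "sat Top vs A = True"
| "sat Bot vs A = False"
| "sat (Node h l) [] A = False"
| "sat (Node h l) (v # vs) A = (if v \<in> A then sat h vs A \<or> sat l vs A else sat l vs A)"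

fun mbf_or :: "mbf \<Rightarrow> mbf \<Rightarrow> mbf" where
  "mbf_or Top t = Top"
| "mbf_or Bot t = t"
| "mbf_or (Node a b) Top = Top"
| "mbf_or (Node a b) Bot = Node a b"
| "mbf_or (Node a b) (Node c d) = Node (mbf_or a c) (mbf_or b d)"

fun mbf_and :: "mbf \<Rightarrow> mbf \<Rightarrow> mbf" where
  "mbf_and Bot t = Bot"
| "mbf_and Top t = t"
| "mbf_and (Node a b) Bot = Bot"
| "mbf_and (Node a b) Top = Node a b"
| "mbf_and (Node a b) (Node c d) = Node (mbf_or (mbf_and a c) (mbf_or (mbf_and a d) (mbf_and b c))) (mbf_and b d)"

text \<open>Disjoint occurrence (the box product): the two factors are to be satisfied by disjoint
  subsets. The product of \<open>a\<close> and \<open>c\<close> is missing since both would use the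
  same element.\<close>

fun mbf_disjoint_and :: "mbf \<Rightarrow> mbf \<Rightarrow> mbf" where
  "mbf_disjoint_and Bot t = Bot"
| "mbf_disjoint_and Top t = t"
| "mbf_disjoint_and (Node a b) Bot = Bot"
| "mbf_disjoint_and (Node a b) Top = Node a b"
| "mbf_disjoint_and (Node a b) (Node c d) =
     Node (mbf_or (mbf_disjoint_and a d) (mbf_disjoint_and b c)) (mbf_disjoint_and b d)"

fun var :: "nat \<Rightarrow> mbf" where
  "var 0 = Node Top Bot"
| "var (Suc n) = Node Bot (var n)"

text \<open>Tests whether every subset of an \<open>n\<close>-element list falsifying the function has fewer than \<open>k\<close>
elements; false negatives are possible.\<close>

fun models_smaller :: "nat \<Rightarrow> nat \<Rightarrow> mbf \<Rightarrow> bool" where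
  "models_smaller k n Top = True"
| "models_smaller k n Bot = (n < k)"
| "models_smaller k 0 (Node h l) = (0 < k)"
| "models_smaller 0 (Suc n) (Node h l) = False"
| "models_smaller (Suc k) (Suc n) (Node h l) =
     (if n < k then True else models_smaller k n (mbf_or h l) \<and> models_smaller (Suc k) n l)"

section \<open>Semantics of the decision diagrams\<close>

lemma sat_or [simp]: "sat (mbf_or s t) vs A \<longleftrightarrow> sat s vs A \<or> sat t vs A"
proof (induction s t arbitrary: vs rule: mbf_or.induct)
  case (5 a b c d)
  then show ?case by (cases vs) auto
qed auto

lemma sat_and [simp]: "sat (mbf_and s t) vs A \<longleftrightarrow> sat s vs A \<and> sat t vs A"
proof (induction s t arbitrary: vs rule: mbf_and.induct)
  case (5 a b c d)
  then show ?case by (cases vs) auto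
qed auto

lemma sat_var [simp]: "sat (var n) vs A \<longleftrightarrow> n < length vs \<and> vs ! n \<in> A"
proof (induction n arbitrary: vs)
  case 0
  then show ?case by (cases vs) auto
next
  case (Suc n)
  then show ?case by (cases vs) auto
qed

lemma sat_cong: "(\<And>v. v \<in> set vs \<Longrightarrow> v \<in> A \<longleftrightarrow> v \<in> B) \<Longrightarrow> sat t vs A \<longleftrightarrow> sat t vs B"
  by (induction t vs A rule: sat.induct) auto

lemma sat_insert_notin: "v \<notin> set vs \<Longrightarrow> sat t vs (insert v A) \<longleftrightarrow> sat t vs A"
  by (rule sat_cong) auto

lemma sat_diff_notin: "v \<notin> set vs \<Longrightarrow> sat t vs (A - {v}) \<longleftrightarrow> sat t vs A"
  by (rule sat_cong) auto

text \<open>Induction along the list: the head joins the set whose factor takes the high branch and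
  is removed from the other. Distinctness of the list keeps the conditions on the tail
  unaffected.\<close>

lemma sat_mbf_disjoint_and:
  assumes "sat (mbf_disjoint_and s t) vs A" "distinct vs"
  shows "\<exists>B C. B \<subseteq> A \<and> C \<subseteq> A \<and> B \<inter> C = {} \<and> sat s vs B \<and> sat t vs C"
  using assms
proof (induction s t arbitrary: vs rule: mbf_disjoint_and.induct)
  case (5 a b c d)
  from 5(4,5) obtain v ws where vs: "vs = v # ws" "v \<notin> set ws" "distinct ws"
    by (cases vs) auto
  note upd = sat_insert_notin[OF vs(2)] sat_diff_notin[OF vs(2)]
  consider (left) "v \<in> A" "sat (mbf_disjoint_and a d) ws A"
    | (right) "v \<in> A" "sat (mbf_disjoint_and b c) ws A" | (low) "sat (mbf_disjoint_and b d) ws A"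
    using 5(4) unfolding vs(1) by (simp split: if_splits) blast+
  then show ?case
  proof cases
    case left
    obtain B C where "B \<subseteq> A" "C \<subseteq> A" "B \<inter> C = {}" "sat a ws B" "sat d ws C"
      using 5(1)[OF left(2) vs(3)] by blast
    with left(1) have "insert v B \<subseteq> A \<and> C - {v} \<subseteq> A \<and> insert v B \<inter> (C - {v}) = {} \<and>
        sat (Node a b) vs (insert v B) \<and> sat (Node c d) vs (C - {v})"
      by (auto simp: vs(1) upd)
    then show ?thesis by blast
  next
    case right
    obtain B C where "B \<subseteq> A" "C \<subseteq> A" "B \<inter> C = {}" "sat b ws B" "sat c ws C"
      using 5(2)[OF right(2) vs(3)] by blast
    with right(1) have "B - {v} \<subseteq> A \<and> insert v C \<subseteq> A \<and> (B - {v}) \<inter> insert v C = {} \<and>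
        sat (Node a b) vs (B - {v}) \<and> sat (Node c d) vs (insert v C)"
      by (auto simp: vs(1) upd)
    then show ?thesis by blast
  next
    case low
    obtain B C where "B \<subseteq> A" "C \<subseteq> A" "B \<inter> C = {}" "sat b ws B" "sat d ws C"
      using 5(3)[OF low vs(3)] by blast
    then have "B \<subseteq> A \<and> C \<subseteq> A \<and> B \<inter> C = {} \<and> sat (Node a b) vs B \<and> sat (Node c d) vs C"
      by (auto simp: vs(1))
    then show ?thesis by blast
  qed
qed (auto intro: exI[of _ "{}"])

text \<open>If the head lies in \<open>A\<close>, both branches are false on the tail and the bound
  there drops by one; otherwise only \<open>l\<close> is known to be false. Short lists are settled
  by their length.\<close>

lemma card_less_if_models_smaller:
  assumes "models_smaller k n t" "length vs = n" "distinct vs" "\<not> sat t vs A"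
  shows "card (A \<inter> set vs) < k"
  using assms
proof (induction k n t arbitrary: vs rule: models_smaller.induct)
  case (2 k n)
  have "card (A \<inter> set vs) \<le> length vs"
    by (rule order_trans[OF card_mono[OF finite_set Int_lower2] card_length])
  with 2 show ?case by auto
next
  case (5 k n h l)
  from 5(4,5) obtain v ws where vs: "vs = v # ws" "v \<notin> set ws" "distinct ws" "length ws = n"
    by (cases vs) auto
  show ?case
  proof (cases "n < k")
    case True
    have "card (A \<inter> set vs) \<le> length vs"
      by (rule order_trans[OF card_mono[OF finite_set Int_lower2] card_length])
    with True 5(4) show ?thesis by simp
  next
    case False
    show ?thesis
    proof (cases "v \<in> A")
      case True
      then have "card (A \<inter> set ws) < k"
        using 5 False vs by (intro "5.IH"(1)) auto
      moreover have "A \<inter> set vs = insert v (A \<inter> set ws)" using True vs(1) by auto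
      ultimately show ?thesis using vs(2) by simp
    next
      case nv: False
      then have "card (A \<inter> set ws) < Suc k"
        using 5 False vs by (intro "5.IH"(2)) auto
      moreover have "A \<inter> set vs = A \<inter> set ws" using nv vs(1) by auto
      ultimately show ?thesis by simp
    qed
  qed
qed auto

section \<open>Functionals and cones\<close>

definition root_functional :: "(nat \<Rightarrow> real) \<Rightarrow> bool" where
  "root_functional h \<longleftrightarrow> (\<exists>f. (\<forall>x y. f (x + y) = f x + f y) \<and> (\<forall>i<24. h i = f (pos_roots ! i)))"

text \<open>The dual form of cone membership, into which functionals of Weyl group elements can be
  inserted directly. By Farkas' lemma it says that root \<open>i\<close> lies in the cone spanned by
  \<open>A\<close>, as all positive roots lie in an open half-space.\<close>

definition in_cone :: "nat \<Rightarrow> nat set \<Rightarrow> bool" where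
  "in_cone i A \<longleftrightarrow> (\<forall>h. root_functional h \<longrightarrow> (\<forall>a\<in>A. 0 < h a) \<longrightarrow> 0 < h i)"

text \<open>These are the shapes that a root strictly between two others takes in a rank-two system
  of type A2 or B2.\<close>

definition between :: "vec \<Rightarrow> vec \<Rightarrow> vec \<Rightarrow> bool" where
  "between x y z \<longleftrightarrow> z = x + y \<or> z + z = x + y \<or> z = x + x + y \<or> z = x + y + y"

lemma in_cone_mono: "in_cone i A \<Longrightarrow> A \<subseteq> B \<Longrightarrow> in_cone i B"
  unfolding in_cone_def by blast

lemma in_cone_between:
  assumes "in_cone b A" "in_cone c A" "b < 24" "c < 24" "i < 24"
    and "between (pos_roots ! b) (pos_roots ! c) (pos_roots ! i)"
  shows "in_cone i A"
  unfolding in_cone_def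
proof (intro allI impI)
  fix h assume h: "root_functional h" "\<forall>a\<in>A. 0 < h a"
  then obtain f where f: "\<And>x y. f (x + y) = f x + f y" "\<And>i. i < 24 \<Longrightarrow> h i = f (pos_roots ! i)"
    unfolding root_functional_def by blast
  have "0 < f (pos_roots ! b)" "0 < f (pos_roots ! c)"
    using assms(1-4) h f(2)[of b] f(2)[of c] by (auto simp: in_cone_def)
  moreover from assms(6) have "f (pos_roots ! i) = f (pos_roots ! b) + f (pos_roots ! c)
      \<or> f (pos_roots ! i) + f (pos_roots ! i) = f (pos_roots ! b) + f (pos_roots ! c)
      \<or> f (pos_roots ! i) = f (pos_roots ! b) + f (pos_roots ! b) + f (pos_roots ! c)
      \<or> f (pos_roots ! i) = f (pos_roots ! b) + f (pos_roots ! c) + f (pos_roots ! c)"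
    unfolding between_def using f(1) by (elim disjE) (metis f(1))+
  ultimately show "0 < h i" using f(2)[OF assms(5)] by auto
qed

section \<open>Certificates for cone membership\<close>

definition indices :: "nat list" where
  "indices = [0..<24]"

lemma indices [simp]: "length indices = 24" "set indices = {..<24}" "distinct indices"
  "i < 24 \<Longrightarrow> indices ! i = i"
  by (auto simp: indices_def simp del: upt_rec_numeral)

definition rank2_valid :: bool where
  "rank2_valid \<longleftrightarrow> length rank2 = 24 \<and> list_all (\<lambda>(i, ps). list_all
     (\<lambda>(b, c). b < 24 \<and> c < 24 \<and> between (pos_roots ! b) (pos_roots ! c) (pos_roots ! i)) ps)
     (zip indices rank2)"

text \<open>\<open>vs\<close> holds the membership tests and \<open>ts\<close> the conditions
  derived so far. One root of each pair has to be a member of the set, so a round adds at most one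
  generator to an expression.\<close>

definition extend :: "mbf list \<Rightarrow> mbf list \<Rightarrow> (nat \<times> nat) list \<Rightarrow> mbf \<Rightarrow> mbf" where
  "extend vs ts = fold (\<lambda>(b, c). mbf_or (mbf_or (mbf_and (ts ! b) (vs ! c)) (mbf_and (vs ! b) (ts ! c))))"

definition step :: "mbf list \<Rightarrow> mbf list \<Rightarrow> mbf list" where
  "step vs ts = map (\<lambda>(ps, t). extend vs ts ps t) (zip rank2 ts)"

definition triads_hold :: "mbf list \<Rightarrow> bool" where
  "triads_hold ts \<longleftrightarrow> list_all (\<lambda>(i, is). i < 24 \<and> is \<noteq> [] \<and> list_all (\<lambda>j. j < 24) is \<and>
     list_all (\<lambda>j. sat (ts ! i) indices (set (removeAll j is))) is) triads"

text \<open>Detects violations of the property of the private roots: some root has expressions over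
  two disjoint subsets, or a whole triad is present.\<close>

definition redundant :: "mbf list \<Rightarrow> mbf list \<Rightarrow> mbf" where
  "redundant vs ts = fold (\<lambda>t. mbf_or (mbf_disjoint_and t t)) ts
     (fold (\<lambda>(i, is). mbf_or (fold (\<lambda>j. mbf_and (vs ! j)) is Top)) triads Bot)"

text \<open>The tables are arguments of the functions below so that rewriting normalises each of them only
once. Two rounds of \<open>step\<close> produce all expressions of a root by at most three others, which suffices.\<close>

definition at_most_six :: "mbf list \<Rightarrow> mbf list \<Rightarrow> bool" where
  "at_most_six vs ts \<longleftrightarrow> triads_hold ts \<and> models_smaller 7 24 (redundant vs ts)"

lemma rank2_valid: rank2_valid
  by code_simp

lemma at_most_six:
  "at_most_six (map var indices) (step (map var indices) (step (map var indices) (map var indices)))"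
  by code_simp

text \<open>Soundness invariant of a table; the converse implication may fail, since a table holds
  only short expressions.\<close>

definition certifies_cones :: "mbf list \<Rightarrow> bool" where
  "certifies_cones ts \<longleftrightarrow> length ts = 24 \<and> (\<forall>i<24. \<forall>A. sat (ts ! i) indices A \<longrightarrow> in_cone i A)"

lemma certifies_conesD:
  "certifies_cones ts \<Longrightarrow> i < 24 \<Longrightarrow> sat (ts ! i) indices A \<Longrightarrow> in_cone i A"
  unfolding certifies_cones_def by blast

lemma certifies_cones_var: "certifies_cones (map var indices)"
  by (auto simp: certifies_cones_def in_cone_def)

lemma in_cone_extend:
  assumes "certifies_cones vs" "certifies_cones ts" "i < 24"
    and "\<forall>(b, c)\<in>set ps. b < 24 \<and> c < 24 \<and> between (pos_roots ! b) (pos_roots ! c) (pos_roots ! i)"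
    and "sat t indices A \<Longrightarrow> in_cone i A"
    and "sat (extend vs ts ps t) indices A"
  shows "in_cone i A"
  using assms(4-6) unfolding extend_def
proof (induction ps arbitrary: t)
  case (Cons p ps)
  obtain b c where p: "p = (b, c)" by fastforce
  have bc: "b < 24" "c < 24" "between (pos_roots ! b) (pos_roots ! c) (pos_roots ! i)"
    using Cons.prems(1) p by auto
  show ?case
  proof (rule Cons.IH)
    show "sat (fold (\<lambda>(b, c). mbf_or (mbf_or (mbf_and (ts ! b) (vs ! c)) (mbf_and (vs ! b) (ts ! c)))) ps
        (mbf_or (mbf_or (mbf_and (ts ! b) (vs ! c)) (mbf_and (vs ! b) (ts ! c))) t)) indices A"
      using Cons.prems(3) by (simp add: p)
    show "in_cone i A"
      if s: "sat (mbf_or (mbf_or (mbf_and (ts ! b) (vs ! c)) (mbf_and (vs ! b) (ts ! c))) t) indices A"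
    proof (cases "sat t indices A")
      case True
      then show ?thesis by (rule Cons.prems(2))
    next
      case False
      with s assms(1,2) bc(1,2) have "in_cone b A" "in_cone c A"
        by (auto simp: certifies_cones_def)
      then show ?thesis by (rule in_cone_between[OF _ _ bc(1,2) assms(3) bc(3)])
    qed
  qed (use Cons.prems(1) in auto)
qed simp

lemma certifies_cones_step:
  assumes "certifies_cones vs" "certifies_cones ts"
  shows "certifies_cones (step vs ts)"
  unfolding certifies_cones_def
proof (intro conjI allI impI)
  have len: "length rank2 = 24" "length ts = 24"
    using rank2_valid assms(2) unfolding rank2_valid_def certifies_cones_def by auto
  then show "length (step vs ts) = 24" by (simp add: step_def)
  fix i A assume i: "i < (24::nat)" and "sat (step vs ts ! i) indices A"
  then have s: "sat (extend vs ts (rank2 ! i) (ts ! i)) indices A"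
    by (simp add: step_def len)
  have "(i, rank2 ! i) \<in> set (zip indices rank2)"
    using i len by (auto simp: set_zip intro!: exI[of _ i])
  then have valid: "\<forall>(b, c)\<in>set (rank2 ! i). b < 24 \<and> c < 24 \<and> between (pos_roots ! b) (pos_roots ! c) (pos_roots ! i)"
    using rank2_valid unfolding rank2_valid_def list_all_iff by fastforce
  have t: "in_cone i A" if "sat (ts ! i) indices A"
    using that i assms(2) unfolding certifies_cones_def by blast
  show "in_cone i A"
    by (rule in_cone_extend[OF assms i valid t s])
qed

lemma sat_fold_or:
  "sat (fold (\<lambda>x. mbf_or (f x)) xs t) vs A \<longleftrightarrow> sat t vs A \<or> (\<exists>x\<in>set xs. sat (f x) vs A)"
  by (induction xs arbitrary: t) auto

lemma sat_fold_and:
  "sat (fold (\<lambda>x. mbf_and (f x)) xs t) vs A \<longleftrightarrow> sat t vs A \<and> (\<forall>x\<in>set xs. sat (f x) vs A)"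
  by (induction xs arbitrary: t) auto

lemma sat_redundantD:
  assumes "certifies_cones ts" "triads_hold ts"
    and "sat (redundant (map var indices) ts) indices A"
  shows "\<exists>i<24. \<forall>j. in_cone i (A - {j})"
proof -
  have "(\<exists>t\<in>set ts. sat (mbf_disjoint_and t t) indices A) \<or>
      (\<exists>c\<in>set triads. \<forall>j\<in>set (snd c). sat (map var indices ! j) indices A)"
    using assms(3) unfolding redundant_def case_prod_beta sat_fold_or sat_fold_and sat.simps
    by blast
  then show ?thesis
  proof
    assume "\<exists>t\<in>set ts. sat (mbf_disjoint_and t t) indices A"
    then obtain i where i: "i < 24" "sat (mbf_disjoint_and (ts ! i) (ts ! i)) indices A"
      using assms(1) unfolding certifies_cones_def by (metis in_set_conv_nth)
    obtain B C where BC: "B \<subseteq> A" "C \<subseteq> A" "B \<inter> C = {}"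
        "sat (ts ! i) indices B" "sat (ts ! i) indices C"
      using sat_mbf_disjoint_and[OF i(2)] by auto
    note cones = certifies_conesD[OF assms(1) i(1) BC(4)] certifies_conesD[OF assms(1) i(1) BC(5)]
    \<comment> \<open>A single \<open>j\<close> misses one of the disjoint sets \<open>B\<close> and
      \<open>C\<close>, and that set still yields root \<open>i\<close>.\<close>
    have "in_cone i (A - {j})" for j
    proof (cases "j \<in> B")
      case True
      with BC have "C \<subseteq> A - {j}" by blast
      with cones(2) show ?thesis by (rule in_cone_mono)
    next
      case False
      with BC have "B \<subseteq> A - {j}" by blast
      with cones(1) show ?thesis by (rule in_cone_mono)
    qed
    with i(1) show ?thesis by blast
  next
    assume "\<exists>c\<in>set triads. \<forall>j\<in>set (snd c). sat (map var indices ! j) indices A"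
    then obtain c where c: "c \<in> set triads"
        "\<forall>j\<in>set (snd c). sat (map var indices ! j) indices A" ..
    obtain i "is" where ci: "c = (i, is)" by (cases c)
    from assms(2) c(1) have "i < 24 \<and> is \<noteq> [] \<and> list_all (\<lambda>j. j < 24) is \<and>
        list_all (\<lambda>j. sat (ts ! i) indices (set (removeAll j is))) is"
      unfolding triads_hold_def list_all_iff[of _ triads] ci by (auto dest: bspec)
    then have i: "i < 24" and ne: "is \<noteq> []" and lt: "\<And>j. j \<in> set is \<Longrightarrow> j < 24"
      and s: "\<And>j. j \<in> set is \<Longrightarrow> sat (ts ! i) indices (set is - {j})"
      by (simp_all add: list_all_iff)
    have sub: "set is \<subseteq> A"
    proof
      fix j assume "j \<in> set is"
      with bspec[OF c(2), of j] lt[of j] show "j \<in> A" by (simp add: ci)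
    qed
    have cone: "in_cone i (set is - {j})" if "j \<in> set is" for j
      by (rule certifies_conesD[OF assms(1) i s[OF that]])
    have "in_cone i (A - {j})" for j
    proof (cases "j \<in> set is")
      case True
      have "set is - {j} \<subseteq> A - {j}" using sub by blast
      then show ?thesis by (rule in_cone_mono[OF cone[OF True]])
    next
      case False
      \<comment> \<open>For \<open>j\<close> outside the triad any of its reduced sets will do; the
        head exists because the list is nonempty.\<close>
      have hd: "hd is \<in> set is" using ne by simp
      have "set is - {hd is} \<subseteq> A - {j}" using sub False by blast
      then show ?thesis by (rule in_cone_mono[OF cone[OF hd]])
    qed
    with i show ?thesis by blast
  qed
qed

text \<open>The assumption denies that some root stays in the cone after every single removal, so
  \<open>A\<close> falsifies \<open>redundant\<close> and the search bounds its size.\<close>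

lemma card_less_7_if_not_in_cone:
  assumes "A \<subseteq> {..<24}" "\<And>i. i < 24 \<Longrightarrow> \<exists>j\<in>A. \<not> in_cone i (A - {j})"
  shows "card A < 7"
proof -
  define vs where "vs = map var indices"
  define ts where "ts = step vs (step vs vs)"
  have "certifies_cones ts"
    unfolding ts_def vs_def by (intro certifies_cones_step certifies_cones_var)
  moreover have six: "triads_hold ts" "models_smaller 7 24 (redundant vs ts)"
    using at_most_six unfolding at_most_six_def ts_def vs_def by auto
  ultimately have "\<not> sat (redundant vs ts) indices A"
    using sat_redundantD assms(2) unfolding vs_def by blast
  with six(2) have "card (A \<inter> set indices) < 7"
    by (intro card_less_if_models_smaller) auto
  moreover have "A \<inter> set indices = A" using assms(1) by auto
  ultimately show ?thesis by simp
qed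

section \<open>The root system in coordinates\<close>

definition basis :: "vec list" where
  "basis = [(1, 0, 0, 0), (0, 1, 0, 0), (0, 0, 1, 0), (0, 0, 0, 1)]"

fun scale :: "int \<Rightarrow> vec \<Rightarrow> vec" where
  "scale k (x1, x2, x3, x4) = (k * x1, k * x2, k * x3, k * x4)"

fun nonneg :: "vec \<Rightarrow> bool" where
  "nonneg (x1, x2, x3, x4) \<longleftrightarrow> 0 \<le> x1 \<and> 0 \<le> x2 \<and> 0 \<le> x3 \<and> 0 \<le> x4"

text \<open>The inner product in units of half the squared length of a short root.\<close>

fun form :: "vec \<Rightarrow> vec \<Rightarrow> int" where
  "form (x1, x2, x3, x4) (y1, y2, y3, y4) =
     4 * x1 * y1 + 4 * x2 * y2 + 2 * x3 * y3 + 2 * x4 * y4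
     - 2 * (x1 * y2 + x2 * y1) - 2 * (x2 * y3 + x3 * y2) - (x3 * y4 + x4 * y3)"

text \<open>The integer division is exact when \<open>b\<close> is a positive root, by
  \<open>dvd_pos_roots\<close>.\<close>

definition reflect :: "vec \<Rightarrow> vec \<Rightarrow> vec" where
  "reflect b x = x - scale (2 * form x b div form b b) b"

lemma nonneg_add: "nonneg x \<Longrightarrow> nonneg y \<Longrightarrow> nonneg (x + y)"
  by (cases x; cases y) simp

lemma form_pos:
  assumes "x \<noteq> 0" shows "0 < form x x"
proof -
  obtain a b c d where x: "x = (a, b, c, d)" by (cases x)
  \<comment> \<open>Completing squares one variable at a time; the factor 6 clears
    denominators.\<close>
  have eq: "6 * form x x = 6 * (2 * a - b)\<^sup>2 + 2 * (3 * b - 2 * c)\<^sup>2 + (2 * c - 3 * d)\<^sup>2 + 3 * d\<^sup>2"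
    by (simp add: x power2_eq_square algebra_simps)
  show ?thesis
  proof (rule ccontr)
    assume "\<not> 0 < form x x"
    with eq have *: "6 * (2 * a - b)\<^sup>2 + 2 * (3 * b - 2 * c)\<^sup>2 + (2 * c - 3 * d)\<^sup>2 + 3 * d\<^sup>2 \<le> 0"
      by simp
    have "(2 * a - b)\<^sup>2 \<ge> 0" "(3 * b - 2 * c)\<^sup>2 \<ge> 0" "(2 * c - 3 * d)\<^sup>2 \<ge> 0" "d\<^sup>2 \<ge> 0"
      by simp_all
    with * have "(2 * a - b)\<^sup>2 = 0" "(3 * b - 2 * c)\<^sup>2 = 0" "(2 * c - 3 * d)\<^sup>2 = 0" "d\<^sup>2 = 0"
      by linarith+
    then have "x = 0" by (simp add: x zero_prod_def)
    with assms show False by simp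
  qed
qed

lemma form_expand:
  "form (x1, x2, x3, x4) y = x1 * form (basis ! 0) y + x2 * form (basis ! 1) y
     + x3 * form (basis ! 2) y + x4 * form (basis ! 3) y"
  by (cases y) (simp add: basis_def algebra_simps)

lemma set_basis_nth: "set basis = {basis ! 0, basis ! 1, basis ! 2, basis ! 3}"
  by (simp add: basis_def)

lemma form_dvd:
  assumes "\<forall>e\<in>set basis. m dvd 2 * form e b" shows "m dvd 2 * form x b"
proof -
  obtain x1 x2 x3 x4 where x: "x = (x1, x2, x3, x4)" by (cases x)
  have "2 * form x b = x1 * (2 * form (basis ! 0) b) + x2 * (2 * form (basis ! 1) b)
     + x3 * (2 * form (basis ! 2) b) + x4 * (2 * form (basis ! 3) b)"
    unfolding x form_expand[of x1] by (simp add: algebra_simps)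
  with assms show ?thesis
    unfolding set_basis_nth by (simp add: dvd_add dvd_mult)
qed

text \<open>Off the coordinate of \<open>e\<close>, nonnegative numbers add up to 0. This is why a
  simple reflection makes only its own root negative.\<close>

lemma multiple_of_basis:
  assumes "nonneg x" "nonneg y" "e \<in> set basis" "x + y = scale k e"
  shows "\<exists>t. x = scale t e"
proof -
  obtain x1 x2 x3 x4 where x: "x = (x1, x2, x3, x4)" by (cases x)
  obtain y1 y2 y3 y4 where y: "y = (y1, y2, y3, y4)" by (cases y)
  from assms show ?thesis by (auto simp: x y basis_def)
qed

text \<open>Each root is simple or is mapped by a simple reflection to an earlier one.\<close>

fun reached :: "vec list \<Rightarrow> vec list \<Rightarrow> bool" where
  "reached [] ys = True"
| "reached (x # xs) ys \<longleftrightarrow>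
     (x \<in> set basis \<or> list_ex (\<lambda>e. reflect e x \<in> set ys) basis) \<and> reached xs (x # ys)"

definition root_data_ok :: bool where
  "root_data_ok \<longleftrightarrow> length pos_roots = 24 \<and> reached pos_roots []
     \<and> list_all (\<lambda>e. e \<in> set pos_roots) basis
     \<and> list_all nonneg pos_roots
     \<and> list_all (\<lambda>b. list_all (\<lambda>e. form b b dvd 2 * form e b) basis) pos_roots
     \<and> list_all (\<lambda>e. list_all (\<lambda>x. x = e \<or> reflect e x \<in> set pos_roots) pos_roots) basis
     \<and> list_all (\<lambda>b. b \<noteq> 0) pos_roots"

lemma root_data_ok: root_data_ok
  by code_simp

lemma length_pos_roots: "length pos_roots = 24"
  and reached_pos_roots: "reached pos_roots []"
  and basis_subset: "set basis \<subseteq> set pos_roots"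
  and nonneg_pos_roots: "x \<in> set pos_roots \<Longrightarrow> nonneg x"
  and dvd_pos_roots: "b \<in> set pos_roots \<Longrightarrow> form b b dvd 2 * form x b"
  and reflect_pos_roots: "e \<in> set basis \<Longrightarrow> x \<in> set pos_roots \<Longrightarrow> x = e \<or> reflect e x \<in> set pos_roots"
  and pos_roots_nonzero: "b \<in> set pos_roots \<Longrightarrow> b \<noteq> 0"
proof -
  note ok = root_data_ok[unfolded root_data_ok_def list_all_iff]
  show "length pos_roots = 24" "reached pos_roots []" using ok by simp_all
  show "set basis \<subseteq> set pos_roots" using ok by (intro subsetI) (elim conjE, erule (1) bspec)
  show "nonneg x" if "x \<in> set pos_roots" using ok that by simp
  show "form b b dvd 2 * form x b" if "b \<in> set pos_roots"
    using ok that by (intro form_dvd) simp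
  show "x = e \<or> reflect e x \<in> set pos_roots" if "e \<in> set basis" "x \<in> set pos_roots"
    using ok that by simp
  show "b \<noteq> 0" if "b \<in> set pos_roots" using ok that by simp
qed

text \<open>A pair \<open>(b, d)\<close> stands for the product of the reflections in \<open>b\<close> and \<open>d\<close>.\<close>

fun inverted :: "vec \<times> vec \<Rightarrow> vec \<Rightarrow> bool" where
  "inverted (b, d) x \<longleftrightarrow> - reflect d (reflect b x) \<in> set pos_roots"

definition cover :: "(vec \<times> vec) list" where
  "cover = map (\<lambda>(i, j). (pos_roots ! i, pos_roots ! j))
     [(0, 15), (0, 18), (1, 18), (2, 17), (6, 17), (10, 16)]"

definition cover_ok :: bool where
  "cover_ok \<longleftrightarrow> distinct cover \<and> length cover = 6
     \<and> list_all (\<lambda>u. fst u \<in> set pos_roots \<and> snd u \<in> set pos_roots) cover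
     \<and> list_all (\<lambda>x. list_ex (\<lambda>u. inverted u x) cover) pos_roots
     \<and> list_all (\<lambda>u. list_ex (\<lambda>x. inverted u x \<and> list_all (\<lambda>v. v \<noteq> u \<longrightarrow> \<not> inverted v x) cover)
         pos_roots) cover"

lemma cover_ok: cover_ok
  by code_simp

section \<open>Reflections and the Weyl group\<close>

lemma reflection_linear: "linear (reflection \<alpha>)"
proof (rule linearI)
  fix x y r
  have "cartan_integer (x + y) \<alpha> = cartan_integer x \<alpha> + cartan_integer y \<alpha>"
    by (simp add: cartan_integer_def inner_add_left distrib_left add_divide_distrib)
  then show "reflection \<alpha> (x + y) = reflection \<alpha> x + reflection \<alpha> y"
    by (simp add: reflection_def scaleR_add_left)
  have "cartan_integer (r *\<^sub>R x) \<alpha> = r * cartan_integer x \<alpha>"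
    by (simp add: cartan_integer_def)
  then show "reflection \<alpha> (r *\<^sub>R x) = r *\<^sub>R reflection \<alpha> x"
    by (simp add: reflection_def scaleR_diff_right)
qed

lemma reflection_self: "\<alpha> \<noteq> 0 \<Longrightarrow> reflection \<alpha> \<alpha> = - \<alpha>"
  by (simp add: reflection_def cartan_integer_def algebra_simps scaleR_2)

lemma reflection_involution: "\<alpha> \<noteq> 0 \<Longrightarrow> reflection \<alpha> (reflection \<alpha> x) = x"
  by (simp add: reflection_def cartan_integer_def inner_diff_left algebra_simps)

lemma bij_reflection: "\<alpha> \<noteq> 0 \<Longrightarrow> bij (reflection \<alpha>)"
  by (rule involuntory_imp_bij) (rule reflection_involution)

lemma inv_into_reflection: "\<alpha> \<noteq> 0 \<Longrightarrow> inv_into UNIV (reflection \<alpha>) = reflection \<alpha>"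
  by (rule inv_equality) (simp_all add: reflection_involution)

lemma Bij_UNIV: "f \<in> Bij UNIV \<longleftrightarrow> bij f"
  by (auto simp: Bij_def extensional_def)

lemma BijGroup_UNIV_mult:
  "bij f \<Longrightarrow> bij g \<Longrightarrow> f \<otimes>\<^bsub>BijGroup UNIV\<^esub> g = f \<circ> g"
  by (simp add: BijGroup_def Bij_UNIV compose_def comp_def restrict_def)

text \<open>The generators are involutions, so the case of inverses reduces to that of generators.
  Bijectivity is proved alongside because multiplication in \<open>BijGroup\<close> is composition
  only on bijections.\<close>

lemma weyl_group_induct [consumes 2, case_names id reflection comp]:
  assumes "w \<in> weyl_group \<Delta>" "0 \<notin> \<Delta>"
    and "Q id" "\<And>\<alpha>. \<alpha> \<in> \<Delta> \<Longrightarrow> Q (reflection \<alpha>)"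
    and "\<And>f g. bij f \<Longrightarrow> bij g \<Longrightarrow> Q f \<Longrightarrow> Q g \<Longrightarrow> Q (f \<circ> g)"
  shows "bij w \<and> Q w"
  using assms(1) unfolding weyl_group_def
proof (induction rule: generate.induct)
  case one
  have "\<one>\<^bsub>BijGroup (UNIV :: 'a set)\<^esub> = id"
    by (auto simp: BijGroup_def restrict_def)
  then show ?case using assms(3) bij_id by metis
next
  case (incl h)
  then show ?case using assms(2,4) bij_reflection by (metis imageE)
next
  case (inv h)
  then obtain \<alpha> where \<alpha>: "\<alpha> \<in> \<Delta>" "h = reflection \<alpha>" by blast
  then have nz: "\<alpha> \<noteq> 0" using assms(2) by blast
  have "inv\<^bsub>BijGroup UNIV\<^esub> h = reflection \<alpha>"
    using inv_BijGroup[of h UNIV] bij_reflection[OF nz] inv_into_reflection[OF nz] \<alpha>(2)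
    by (simp add: Bij_UNIV restrict_def)
  then show ?case using assms(4) \<alpha>(1) bij_reflection[OF nz] by simp
next
  case (eng f g)
  then have "f \<otimes>\<^bsub>BijGroup UNIV\<^esub> g = f \<circ> g" by (intro BijGroup_UNIV_mult) auto
  with eng show ?case using assms(5) bij_comp by metis
qed

text \<open>The Cartan matrix enters as the Gram matrix of the simple roots, which it determines up
  to scale; \<open>c\<close> is half the squared length of a short root, the unit of
  \<open>form\<close>.\<close>

locale F4_root_system =
  fixes \<Delta> P :: "'a::euclidean_space set" and a1 a2 a3 a4 \<rho> :: 'a and c :: real
  assumes root_system: "root_system \<Delta>"
    and regular: "\<And>\<alpha>. \<alpha> \<in> \<Delta> \<Longrightarrow> \<rho> \<bullet> \<alpha> \<noteq> 0"
    and P_def: "P = {\<alpha>\<in>\<Delta>. \<rho> \<bullet> \<alpha> > 0}"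
    and simple_roots_eq: "simple_roots P = {a1, a2, a3, a4}"
    and c_pos: "0 < c"
    and gram: "a1 \<bullet> a1 = 4 * c" "a2 \<bullet> a2 = 4 * c" "a3 \<bullet> a3 = 2 * c" "a4 \<bullet> a4 = 2 * c"
      "a1 \<bullet> a2 = - 2 * c" "a1 \<bullet> a3 = 0" "a1 \<bullet> a4 = 0" "a2 \<bullet> a3 = - 2 * c" "a2 \<bullet> a4 = 0"
      "a3 \<bullet> a4 = - c"
begin

fun emb :: "vec \<Rightarrow> 'a" where
  "emb (x1, x2, x3, x4) = of_int x1 *\<^sub>R a1 + of_int x2 *\<^sub>R a2 + of_int x3 *\<^sub>R a3 + of_int x4 *\<^sub>R a4"

lemma emb_add: "emb (x + y) = emb x + emb y"
  by (cases x; cases y) (simp add: algebra_simps)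

lemma emb_diff: "emb (x - y) = emb x - emb y"
  by (cases x; cases y) (simp add: algebra_simps)

lemma emb_uminus: "emb (- x) = - emb x"
  by (cases x) (simp add: algebra_simps)

lemma emb_scale: "emb (scale k x) = of_int k *\<^sub>R emb x"
  by (cases x) (simp add: algebra_simps)

lemma emb_inner: "emb x \<bullet> emb y = c * of_int (form x y)"
proof -
  have sym: "a2 \<bullet> a1 = - 2 * c" "a3 \<bullet> a1 = 0" "a4 \<bullet> a1 = 0" "a3 \<bullet> a2 = - 2 * c" "a4 \<bullet> a2 = 0"
      "a4 \<bullet> a3 = - c"
    using gram by (simp_all add: inner_commute)
  show ?thesis
    by (cases x; cases y) (simp add: inner_add_left inner_add_right gram sym algebra_simps)
qed

text \<open>Positive definiteness of \<open>form\<close> makes the simple roots independent over the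
  integers, so coordinates are unique.\<close>

lemma emb_eq_0_iff: "emb x = 0 \<longleftrightarrow> x = 0"
proof
  assume "emb x = 0"
  with emb_inner[of x x] c_pos have "form x x = 0" by simp
  with form_pos[of x] show "x = 0" by force
qed (simp add: zero_prod_def)

lemma inj_emb: "inj emb"
proof (rule injI)
  fix x y assume "emb x = emb y"
  then have "emb (x - y) = 0" by (simp add: emb_diff)
  then show "x = y" by (simp add: emb_eq_0_iff)
qed

lemma emb_basis: "emb ` set basis = {a1, a2, a3, a4}"
  by (simp add: basis_def)

lemma reflection_emb:
  assumes "b \<in> set pos_roots"
  shows "reflection (emb b) (emb x) = emb (reflect b x)"
proof -
  have pos: "0 < form b b" using form_pos pos_roots_nonzero[OF assms] .
  obtain k where k: "2 * form x b = form b b * k" using dvd_pos_roots[OF assms] by blast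
  then have "2 * of_int (form x b) = (of_int (form b b) * of_int k :: real)"
    by (metis of_int_mult of_int_numeral)
  then have "cartan_integer (emb x) (emb b) = of_int k"
    unfolding cartan_integer_def emb_inner using c_pos pos by (simp add: field_simps)
  moreover have "2 * form x b div form b b = k" using k pos by simp
  ultimately show ?thesis by (simp add: reflection_def reflect_def emb_diff emb_scale)
qed

section \<open>Identification of the positive roots\<close>

lemma finite_\<Delta>: "finite \<Delta>" and zero_notin: "0 \<notin> \<Delta>"
  and reflection_image: "\<alpha> \<in> \<Delta> \<Longrightarrow> reflection \<alpha> ` \<Delta> = \<Delta>"
  and line: "\<alpha> \<in> \<Delta> \<Longrightarrow> \<Delta> \<inter> span {\<alpha>} = {\<alpha>, - \<alpha>}"
  using root_system unfolding root_system_def by auto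

lemma reflection_mem: "\<alpha> \<in> \<Delta> \<Longrightarrow> \<beta> \<in> \<Delta> \<Longrightarrow> reflection \<alpha> \<beta> \<in> \<Delta>"
  using reflection_image by blast

lemma uminus_mem: "\<alpha> \<in> \<Delta> \<Longrightarrow> - \<alpha> \<in> \<Delta>"
  using line by blast

lemma P_subset: "P \<subseteq> \<Delta>"
  by (auto simp: P_def)

lemma P_pos: "\<alpha> \<in> P \<Longrightarrow> 0 < \<rho> \<bullet> \<alpha>"
  by (simp add: P_def)

lemma P_cases: "\<alpha> \<in> \<Delta> \<Longrightarrow> \<alpha> \<notin> P \<Longrightarrow> - \<alpha> \<in> P"
  using regular[of \<alpha>] uminus_mem[of \<alpha>] by (auto simp: P_def)

lemma uminus_P_iff: "\<alpha> \<in> \<Delta> \<Longrightarrow> \<alpha> \<in> uminus ` P \<longleftrightarrow> \<rho> \<bullet> \<alpha> < 0"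
  using uminus_mem[of \<alpha>] by (auto simp: P_def intro!: image_eqI[of _ _ "- \<alpha>"])

lemma basis_in_P:
  assumes "e \<in> set basis" shows "emb e \<in> P"
proof -
  have "emb e \<in> simple_roots P"
    unfolding simple_roots_eq emb_basis[symmetric] using assms by (rule imageI)
  then show ?thesis by (simp add: simple_roots_def)
qed

text \<open>The values of \<open>\<rho>\<close> are real, so well-foundedness comes from counting
  the finitely many positive roots of smaller value.\<close>

lemma P_induct [consumes 1, case_names less]:
  assumes "\<alpha> \<in> P"
    and "\<And>\<alpha>. \<alpha> \<in> P \<Longrightarrow> (\<And>\<beta>. \<beta> \<in> P \<Longrightarrow> \<rho> \<bullet> \<beta> < \<rho> \<bullet> \<alpha> \<Longrightarrow> Q \<beta>) \<Longrightarrow> Q \<alpha>"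
  shows "Q \<alpha>"
  using assms(1)
proof (induction "card {\<beta>\<in>P. \<rho> \<bullet> \<beta> < \<rho> \<bullet> \<alpha>}" arbitrary: \<alpha> rule: less_induct)
  case less
  have fin: "finite P" using finite_subset[OF P_subset finite_\<Delta>] .
  show ?case
  proof (rule assms(2)[OF less.prems])
    fix \<beta> assume \<beta>: "\<beta> \<in> P" "\<rho> \<bullet> \<beta> < \<rho> \<bullet> \<alpha>"
    then have "{\<gamma>\<in>P. \<rho> \<bullet> \<gamma> < \<rho> \<bullet> \<beta>} \<subset> {\<gamma>\<in>P. \<rho> \<bullet> \<gamma> < \<rho> \<bullet> \<alpha>}" by force
    with fin \<beta>(1) show "Q \<beta>" by (intro less.hyps psubset_card_mono) auto
  qed
qed

lemma P_coordinates: "\<alpha> \<in> P \<Longrightarrow> \<exists>x. \<alpha> = emb x \<and> nonneg x"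
proof (induction rule: P_induct)
  case (less \<alpha>)
  show ?case
  proof (cases "\<alpha> \<in> simple_roots P")
    case True
    then obtain e where "e \<in> set basis" "\<alpha> = emb e"
      unfolding simple_roots_eq emb_basis[symmetric] by blast
    then show ?thesis using basis_subset nonneg_pos_roots by blast
  next
    case False
    with less.hyps obtain \<beta> \<gamma> where *: "\<beta> \<in> P" "\<gamma> \<in> P" "\<alpha> = \<beta> + \<gamma>"
      by (auto simp: simple_roots_def)
    then have "\<rho> \<bullet> \<beta> < \<rho> \<bullet> \<alpha>" "\<rho> \<bullet> \<gamma> < \<rho> \<bullet> \<alpha>"
      using P_pos by (auto simp: inner_add_right)
    with less.IH *(1,2) obtain x y where "\<beta> = emb x" "nonneg x" "\<gamma> = emb y" "nonneg y" by metis
    then show ?thesis using *(3) emb_add nonneg_add by metis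
  qed
qed

text \<open>Descent: a positive root that is not simple is carried by some simple reflection to a
  positive root of smaller value. That one is listed by induction, and reflecting back stays in the
  list.\<close>

lemma P_subset_roots: "\<alpha> \<in> P \<Longrightarrow> \<alpha> \<in> emb ` set pos_roots"
proof (induction rule: P_induct)
  case (less \<alpha>)
  obtain x where x: "\<alpha> = emb x" "nonneg x" using P_coordinates[OF less.hyps] by blast
  have \<alpha>: "\<alpha> \<in> \<Delta>" using less.hyps P_subset by blast
  then have "x \<noteq> 0" using x(1) zero_notin emb_eq_0_iff by metis
  then have "0 < form x x" by (rule form_pos)
  \<comment> \<open>Otherwise \<open>form x x\<close>, a combination of these products with
    nonnegative coefficients, could not be positive.\<close>
  have "\<exists>e\<in>set basis. 0 < form e x"
  proof (rule ccontr)
    assume "\<not> ?thesis"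
    then have neg: "form (basis ! 0) x \<le> 0" "form (basis ! 1) x \<le> 0" "form (basis ! 2) x \<le> 0"
        "form (basis ! 3) x \<le> 0"
      unfolding set_basis_nth by auto
    obtain x1 x2 x3 x4 where xs: "x = (x1, x2, x3, x4)" by (cases x)
    have "form x x = x1 * form (basis ! 0) x + x2 * form (basis ! 1) x
       + x3 * form (basis ! 2) x + x4 * form (basis ! 3) x"
      using form_expand[of x1 x2 x3 x4 x] xs by simp
    moreover have "x1 * form (basis ! 0) x \<le> 0" "x2 * form (basis ! 1) x \<le> 0"
        "x3 * form (basis ! 2) x \<le> 0" "x4 * form (basis ! 3) x \<le> 0"
      using neg x(2) xs by (auto intro: mult_nonneg_nonpos)
    ultimately show False using \<open>0 < form x x\<close> by linarith
  qed
  then obtain e where e: "e \<in> set basis" "0 < form e x" by blast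
  have eR: "e \<in> set pos_roots" using e(1) basis_subset by blast
  have eP: "emb e \<in> P" using basis_in_P[OF e(1)] .
  then have e\<Delta>: "emb e \<in> \<Delta>" and enz: "emb e \<noteq> 0" using P_subset zero_notin by auto
  show ?case
  proof (cases "x = e")
    case True
    then show ?thesis using x(1) eR by blast
  next
    case False
    define \<beta> where "\<beta> = reflection (emb e) \<alpha>"
    have \<beta>: "\<beta> \<in> \<Delta>" unfolding \<beta>_def by (rule reflection_mem[OF e\<Delta> \<alpha>])
    have \<beta>_emb: "\<beta> = emb (reflect e x)" unfolding \<beta>_def x(1) by (rule reflection_emb[OF eR])
    have "\<beta> \<in> P"
    proof (rule ccontr)
      assume "\<beta> \<notin> P"
      from P_coordinates[OF P_cases[OF \<beta> this]] obtain y where y: "- \<beta> = emb y" "nonneg y" by blast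
      then have "emb (- reflect e x) = emb y" by (simp add: emb_uminus \<beta>_emb)
      then have "y = - reflect e x" using inj_emb by (metis injD)
      \<comment> \<open>If the reflected root is negative, \<open>x + y\<close> is a multiple of
        \<open>e\<close>, hence so is \<open>x\<close>; as \<open>\<Delta>\<close> is reduced,
        \<open>x\<close> is \<open>e\<close>.\<close>
      then have "x + y = scale (2 * form x e div form e e) e" by (simp add: reflect_def)
      then obtain t where "x = scale t e" using multiple_of_basis[OF x(2) y(2) e(1)] by blast
      then have "\<alpha> \<in> span {emb e}" using x(1) emb_scale by (simp add: span_base span_scale)
      with \<alpha> line[OF e\<Delta>] have "\<alpha> = emb e \<or> \<alpha> = - emb e" by blast
      moreover have "\<alpha> \<noteq> - emb e" using P_pos[OF less.hyps] P_pos[OF eP] by auto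
      ultimately have "x = e" using x(1) inj_emb by (metis injD)
      with False show False ..
    qed
    moreover have "\<rho> \<bullet> \<beta> < \<rho> \<bullet> \<alpha>"
    proof -
      have "0 < emb x \<bullet> emb e" using e(2) c_pos by (simp add: emb_inner[of e x] inner_commute[of "emb x"])
      moreover have "0 < emb e \<bullet> emb e" using enz by simp
      ultimately have "0 < cartan_integer \<alpha> (emb e)" by (simp add: cartan_integer_def x(1))
      then show ?thesis using P_pos[OF eP] by (simp add: \<beta>_def reflection_def inner_diff_right)
    qed
    ultimately obtain z where z: "z \<in> set pos_roots" "\<beta> = emb z" using less.IH by blast
    have "\<alpha> = reflection (emb e) \<beta>" by (simp add: \<beta>_def reflection_involution[OF enz])
    also have "\<dots> = emb (reflect e z)" unfolding z(2) by (rule reflection_emb[OF eR])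
    finally have \<alpha>_emb: "\<alpha> = emb (reflect e z)" .
    \<comment> \<open>\<open>e\<close> is the only listed root that \<open>reflect e\<close> may
      take off the list; it would make \<open>\<alpha>\<close> negative.\<close>
    have "z \<noteq> e"
    proof
      assume "z = e"
      then have "\<alpha> = - emb e"
        using \<open>\<alpha> = reflection (emb e) \<beta>\<close> z(2) reflection_self[OF enz] by simp
      then show False using P_pos[OF less.hyps] P_pos[OF eP] by auto
    qed
    then have "reflect e z \<in> set pos_roots" using reflect_pos_roots[OF e(1) z(1)] by blast
    then show ?thesis using \<alpha>_emb by blast
  qed
qed

text \<open>\<open>ys\<close> collects roots already known to lie in \<open>\<Delta>\<close>; the
  simple reflection taking \<open>x\<close> to one of them is an involution and leads back.\<close>

lemma reached_\<Delta>: "reached xs ys \<Longrightarrow> emb ` set ys \<subseteq> \<Delta> \<Longrightarrow> emb ` set xs \<subseteq> \<Delta>"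
proof (induction xs arbitrary: ys)
  case (Cons x xs)
  have "emb x \<in> \<Delta>"
  proof (cases "x \<in> set basis")
    case True
    then show ?thesis using basis_in_P P_subset by blast
  next
    case False
    with Cons.prems(1) obtain e where e: "e \<in> set basis" "reflect e x \<in> set ys"
      by (auto simp: list_ex_iff)
    have e\<Delta>: "emb e \<in> \<Delta>" using basis_in_P[OF e(1)] P_subset by blast
    have "emb (reflect e x) \<in> \<Delta>" using e(2) Cons.prems(2) by blast
    then have "reflection (emb e) (emb (reflect e x)) \<in> \<Delta>" by (rule reflection_mem[OF e\<Delta>])
    moreover have "emb (reflect e x) = reflection (emb e) (emb x)"
      by (rule reflection_emb[symmetric]) (rule subsetD[OF basis_subset e(1)])
    moreover have "emb e \<noteq> 0" using e\<Delta> zero_notin by metis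
    ultimately show ?thesis by (simp add: reflection_involution)
  qed
  moreover have "emb ` set xs \<subseteq> \<Delta>"
    by (rule Cons.IH[of "x # ys"]) (use Cons.prems \<open>emb x \<in> \<Delta>\<close> in auto)
  ultimately show ?case by simp
qed simp

lemma P_eq: "P = emb ` set pos_roots"
proof
  show "emb ` set pos_roots \<subseteq> P"
  proof
    fix \<alpha> assume "\<alpha> \<in> emb ` set pos_roots"
    then obtain x where x: "x \<in> set pos_roots" "\<alpha> = emb x" by blast
    have \<alpha>: "\<alpha> \<in> \<Delta>" using reached_\<Delta>[OF reached_pos_roots] x by auto
    have "a1 \<in> P" "a2 \<in> P" "a3 \<in> P" "a4 \<in> P"
      using simple_roots_eq by (auto simp: simple_roots_def)
    then have "0 < \<rho> \<bullet> a1" "0 < \<rho> \<bullet> a2" "0 < \<rho> \<bullet> a3" "0 < \<rho> \<bullet> a4" by (auto dest: P_pos)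
    moreover obtain x1 x2 x3 x4 where xs: "x = (x1, x2, x3, x4)" by (cases x)
    \<comment> \<open>Nonnegative coordinates give a weak inequality; regularity of
      \<open>\<rho>\<close> makes it strict.\<close>
    ultimately have "0 \<le> \<rho> \<bullet> \<alpha>"
      using nonneg_pos_roots[OF x(1)] by (simp add: x(2) inner_add_right)
    with regular[OF \<alpha>] \<alpha> show "\<alpha> \<in> P" by (simp add: P_def)
  qed
qed (use P_subset_roots in blast)

section \<open>The upper bound\<close>

lemma weyl_group_props:
  assumes "w \<in> weyl_group \<Delta>"
  shows "bij w" "linear w" "w ` \<Delta> = \<Delta>"
proof -
  have "bij w \<and> linear w \<and> w ` \<Delta> = \<Delta>"
    using assms zero_notin
  proof (induction rule: weyl_group_induct)
    case (reflection \<alpha>)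
    then show ?case using reflection_linear reflection_image by blast
  next
    case (comp f g)
    then show ?case using linear_compose[of g f] by (metis image_comp)
  qed (simp add: linear_id[unfolded id_def] id_def)
  then show "bij w" "linear w" "w ` \<Delta> = \<Delta>" by auto
qed

definition height :: "('a \<Rightarrow> 'a) \<Rightarrow> nat \<Rightarrow> real" where
  "height w i = \<rho> \<bullet> inv_into UNIV w (emb (pos_roots ! i))"

text \<open>\<open>w\<close> permutes \<open>\<Delta>\<close>, so the preimage of a positive root is
  a root. There \<open>\<rho>\<close> is nonzero, and its sign decides on inversion.\<close>

lemma
  assumes w: "w \<in> weyl_group \<Delta>"
  shows root_functional_height: "root_functional (height w)"
    and height_inversion: "i < 24 \<Longrightarrow> emb (pos_roots ! i) \<in> inversions P w \<longleftrightarrow> height w i < 0"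
    and height_nonzero: "i < 24 \<Longrightarrow> height w i \<noteq> 0"
proof -
  note props = weyl_group_props[OF w]
  have lin: "linear (inv_into UNIV w)"
    using inj_linear_imp_inv_linear[OF props(2)] props(1) bij_is_inj by blast
  show "root_functional (height w)"
    unfolding root_functional_def
    by (intro exI[of _ "\<lambda>x. \<rho> \<bullet> inv_into UNIV w (emb x)"])
      (simp add: height_def emb_add linear_add[OF lin] inner_add_right)
  assume i: "i < 24"
  then have P: "emb (pos_roots ! i) \<in> P" unfolding P_eq using length_pos_roots by simp
  then have "emb (pos_roots ! i) \<in> w ` \<Delta>" using P_subset props(3) by blast
  then have \<Delta>: "inv_into UNIV w (emb (pos_roots ! i)) \<in> \<Delta>"
    using props(1) by (auto simp: bij_is_inj)
  show "emb (pos_roots ! i) \<in> inversions P w \<longleftrightarrow> height w i < 0"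
    using P uminus_P_iff[OF \<Delta>] by (simp add: inversions_def height_def)
  show "height w i \<noteq> 0" using regular[OF \<Delta>] by (simp add: height_def)
qed

lemma card_minimal_inversion_complete_le:
  assumes Y: "Y \<subseteq> weyl_group \<Delta>" and mic: "minimal_inversion_complete P Y"
  shows "card Y \<le> 6"
proof -
  let ?r = "\<lambda>i. emb (pos_roots ! i)"
  have P_nth: "\<exists>i<24. \<alpha> = ?r i" if "\<alpha> \<in> P" for \<alpha>
  proof -
    from that obtain x where x: "\<alpha> = emb x" "x \<in> set pos_roots" unfolding P_eq by (rule imageE)
    from x(2) obtain i where "i < 24" "pos_roots ! i = x"
      unfolding in_set_conv_nth length_pos_roots by blast
    with x(1) show ?thesis by blast
  qed
  have "\<exists>i. i < 24 \<and> ?r i \<in> inversions P w \<and> (\<forall>v\<in>Y - {w}. ?r i \<notin> inversions P v)"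
    if w: "w \<in> Y" for w
  proof -
    note m = mic[unfolded minimal_inversion_complete_def inversion_complete_def]
    \<comment> \<open>Deleting \<open>w\<close> uncovers some root, which is then private to
      \<open>w\<close>.\<close>
    have "Y - {w} \<subset> Y" using w by blast
    then have "(\<Union>v\<in>Y - {w}. inversions P v) \<noteq> P" by (rule conjunct2[OF m, rule_format])
    moreover have "(\<Union>v\<in>Y - {w}. inversions P v) \<subseteq> P" by (auto simp: inversions_def)
    ultimately obtain \<alpha> where \<alpha>: "\<alpha> \<in> P" "\<alpha> \<notin> (\<Union>v\<in>Y - {w}. inversions P v)" by blast
    with conjunct1[OF m] have "\<alpha> \<in> (\<Union>v\<in>Y. inversions P v)" by simp
    with \<alpha>(2) have "\<alpha> \<in> inversions P w" by blast
    moreover obtain i where "i < 24" "\<alpha> = ?r i" using P_nth[OF \<alpha>(1)] by blast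
    ultimately show ?thesis using \<alpha>(2) by blast
  qed
  then obtain f where f: "\<And>w. w \<in> Y \<Longrightarrow> f w < (24::nat)"
      "\<And>w. w \<in> Y \<Longrightarrow> ?r (f w) \<in> inversions P w"
      "\<And>w v. w \<in> Y \<Longrightarrow> v \<in> Y \<Longrightarrow> v \<noteq> w \<Longrightarrow> ?r (f w) \<notin> inversions P v"
    by (metis DiffI singletonD)
  have "inj_on f Y" using f(2,3) by (metis inj_onI)
  then have "card Y = card (f ` Y)" by (simp add: card_image)
  also have "\<dots> < 7"
  proof (rule card_less_7_if_not_in_cone)
    show "f ` Y \<subseteq> {..<24}" using f(1) by blast
    fix i :: nat assume i: "i < 24"
    then have "?r i \<in> (\<Union>w\<in>Y. inversions P w)"
      using mic length_pos_roots
      unfolding minimal_inversion_complete_def inversion_complete_def by (simp add: P_eq)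
    then obtain w where w: "w \<in> Y" "?r i \<in> inversions P w" by blast
    then have W: "w \<in> weyl_group \<Delta>" using Y by blast
    \<comment> \<open>The removed element is the private root of a \<open>w\<close> that inverts
      root \<open>i\<close>: the functional of \<open>w\<close> is positive on the other private
      roots and negative on root \<open>i\<close>.\<close>
    have "0 < height w j" if "j \<in> f ` Y - {f w}" for j
    proof -
      from that obtain v where v: "v \<in> Y" "v \<noteq> w" "j = f v" by blast
      then have "?r j \<notin> inversions P w" "j < 24" using f(1,3) w(1) by auto
      then show ?thesis using height_inversion[OF W] height_nonzero[OF W] by (meson linorder_neqE)
    qed
    moreover have "height w i < 0" using height_inversion[OF W i] w(2) by blast
    ultimately have "\<not> in_cone i (f ` Y - {f w})"
      using root_functional_height[OF W] unfolding in_cone_def by (meson less_asym)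
    then show "\<exists>j\<in>f ` Y. \<not> in_cone i (f ` Y - {j})" using w(1) by blast
  qed
  finally show ?thesis by simp
qed

section \<open>The lower bound\<close>

fun word :: "vec \<times> vec \<Rightarrow> 'a \<Rightarrow> 'a" where
  "word (b, d) = reflection (emb b) \<circ> reflection (emb d)"

lemma emb_root_mem: "b \<in> set pos_roots \<Longrightarrow> emb b \<in> \<Delta>"
  using P_eq P_subset by blast

lemma word_mem_weyl_group:
  assumes "b \<in> set pos_roots" "d \<in> set pos_roots"
  shows "word (b, d) \<in> weyl_group \<Delta>"
proof -
  have gen: "reflection (emb x) \<in> generate (BijGroup UNIV) (reflection ` \<Delta>)"
    and bij: "bij (reflection (emb x))" if "x \<in> set pos_roots" for x
    using emb_root_mem[OF that] zero_notin by (auto intro: generate.incl bij_reflection)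
  show ?thesis
    using generate.eng[OF gen[OF assms(1)] gen[OF assms(2)]]
      BijGroup_UNIV_mult[OF bij[OF assms(1)] bij[OF assms(2)]]
    by (simp add: weyl_group_def)
qed

lemma inversions_word:
  assumes "b \<in> set pos_roots" "d \<in> set pos_roots" "x \<in> set pos_roots"
  shows "emb x \<in> inversions P (word (b, d)) \<longleftrightarrow> inverted (b, d) x"
proof -
  have nz: "emb b \<noteq> 0" "emb d \<noteq> 0"
    using assms(1,2) emb_root_mem zero_notin by metis+
  have "inv_into UNIV (word (b, d)) = reflection (emb d) \<circ> reflection (emb b)"
    by (rule inv_equality) (simp_all add: reflection_involution nz)
  then have "inv_into UNIV (word (b, d)) (emb x) = emb (reflect d (reflect b x))"
    by (simp add: reflection_emb assms)
  moreover have "emb y \<in> uminus ` P \<longleftrightarrow> - y \<in> set pos_roots" for y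
  proof -
    have "emb y \<in> uminus ` P \<longleftrightarrow> emb (- y) \<in> P"
      by (metis (no_types, lifting) emb_uminus image_iff minus_minus)
    then show ?thesis unfolding P_eq by (simp add: inj_image_mem_iff[OF inj_emb])
  qed
  ultimately show ?thesis using assms(3) by (simp add: inversions_def P_eq)
qed

lemma six_element_minimal_inversion_complete:
  "\<exists>Y. Y \<subseteq> weyl_group \<Delta> \<and> minimal_inversion_complete P Y \<and> card Y = 6"
proof -
  define Y where "Y = word ` set cover"
  note ok = cover_ok[unfolded cover_ok_def list_all_iff list_ex_iff]
  have cover: "fst u \<in> set pos_roots" "snd u \<in> set pos_roots" if "u \<in> set cover" for u
    using ok that by simp_all
  have inv: "emb x \<in> inversions P (word u) \<longleftrightarrow> inverted u x"
    if "u \<in> set cover" "x \<in> set pos_roots" for u x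
    using inversions_word[OF cover[OF that(1)] that(2)] by simp
  have own: "\<exists>x\<in>set pos_roots. inverted u x \<and> (\<forall>v\<in>set cover. v \<noteq> u \<longrightarrow> \<not> inverted v x)"
    if "u \<in> set cover" for u
    using ok that by simp
  \<comment> \<open>Private roots tell the six products apart as maps.\<close>
  have "inj_on word (set cover)"
  proof (rule inj_onI, rule ccontr)
    fix u v assume uv: "u \<in> set cover" "v \<in> set cover" "word u = word v" "u \<noteq> v"
    from own[OF uv(1)] obtain x where x: "x \<in> set pos_roots" "inverted u x"
        "\<forall>v\<in>set cover. v \<noteq> u \<longrightarrow> \<not> inverted v x" by blast
    from x(3) uv(2,4) have "\<not> inverted v x" by simp
    then show False using inv[OF uv(1) x(1)] inv[OF uv(2) x(1)] x(2) uv(3) by simp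
  qed
  then have "card Y = card (set cover)" by (simp add: Y_def card_image)
  also have "\<dots> = 6" using ok distinct_card[of cover] by simp
  finally have card: "card Y = 6" .
  have "Y \<subseteq> weyl_group \<Delta>"
  proof
    fix w assume "w \<in> Y"
    then obtain u where u: "u \<in> set cover" "w = word (fst u, snd u)" unfolding Y_def by auto
    then show "w \<in> weyl_group \<Delta>" using word_mem_weyl_group cover by metis
  qed
  moreover have "minimal_inversion_complete P Y"
    unfolding minimal_inversion_complete_def inversion_complete_def
  proof (intro conjI allI impI)
    show "(\<Union>w\<in>Y. inversions P w) = P"
    proof
      show "(\<Union>w\<in>Y. inversions P w) \<subseteq> P" by (auto simp: inversions_def)
      show "P \<subseteq> (\<Union>w\<in>Y. inversions P w)"
      proof
        fix \<alpha> assume "\<alpha> \<in> P"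
        then obtain x where x: "x \<in> set pos_roots" "\<alpha> = emb x" unfolding P_eq by blast
        then obtain u where "u \<in> set cover" "inverted u x" using ok by blast
        then show "\<alpha> \<in> (\<Union>w\<in>Y. inversions P w)" using inv x unfolding Y_def by blast
      qed
    qed
    fix Z assume Z: "Z \<subset> Y"
    then obtain u where u: "u \<in> set cover" "word u \<notin> Z" unfolding Y_def by blast
    from own[OF u(1)] obtain x where x: "x \<in> set pos_roots" "inverted u x"
        "\<forall>v\<in>set cover. v \<noteq> u \<longrightarrow> \<not> inverted v x" by blast
    have "emb x \<notin> inversions P w" if "w \<in> Z" for w
    proof -
      from that Z obtain v where v: "v \<in> set cover" "w = word v" unfolding Y_def by blast
      with that u(2) have "v \<noteq> u" by blast
      with v x show ?thesis using inv by blast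
    qed
    moreover have "emb x \<in> P" using x(1) unfolding P_eq by blast
    ultimately show "(\<Union>w\<in>Z. inversions P w) \<noteq> P" by blast
  qed
  ultimately show ?thesis using card by blast
qed

lemma MC_eq_6: "MC \<Delta> P = 6"
  unfolding MC_def
proof (rule Max_eqI)
  let ?S = "{card Y |Y. Y \<subseteq> weyl_group \<Delta> \<and> minimal_inversion_complete P Y}"
  have le: "n \<le> 6" if "n \<in> ?S" for n
    using that card_minimal_inversion_complete_le by blast
  \<comment> \<open>The bound itself makes the set of cardinalities finite, as \<open>Max\<close>
    requires.\<close>
  then show "finite ?S" by (meson finite_nat_set_iff_bounded_le)
  show "n \<le> 6" if "n \<in> ?S" for n using le[OF that] .
  show "6 \<in> ?S" using six_element_minimal_inversion_complete by force
qed

end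

text \<open>Opposite Cartan entries express one inner product through two squared lengths. The
  nonzero ones fix the length ratios along the diagram, so all inner products are multiples of
  \<open>c\<close>.\<close>

lemma F4_root_system_exists:
  assumes rs: "root_system \<Delta>" and "positive_system \<Delta> P" and "has_cartan_matrix P F4"
  shows "\<exists>a1 a2 a3 a4 \<rho> c. F4_root_system \<Delta> P a1 a2 a3 a4 \<rho> c"
proof -
  obtain \<rho> where \<rho>: "\<And>\<alpha>. \<alpha> \<in> \<Delta> \<Longrightarrow> \<rho> \<bullet> \<alpha> \<noteq> 0" "P = {\<alpha>\<in>\<Delta>. \<rho> \<bullet> \<alpha> > 0}"
    using assms(2) unfolding positive_system_def by blast
  obtain as where as: "set as = simple_roots P" "length as = length F4"
      and C: "\<And>i j. i < length F4 \<Longrightarrow> j < length F4 \<Longrightarrow>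
        cartan_integer (as ! i) (as ! j) = of_int (F4 ! i ! j)"
    using assms(3) unfolding has_cartan_matrix_def by blast
  have len: "length F4 = 4" by (simp add: F4_def)
  obtain a1 a2 a3 a4 where as_eq: "as = [a1, a2, a3, a4]"
    using as(2) unfolding len by (auto simp: numeral_eq_Suc length_Suc_conv)
  have simple: "simple_roots P = {a1, a2, a3, a4}" using as(1) as_eq by simp
  then have "{a1, a2, a3, a4} \<subseteq> \<Delta>" unfolding simple_roots_def \<rho>(2) by blast
  then have nz: "a1 \<noteq> 0" "a2 \<noteq> 0" "a3 \<noteq> 0" "a4 \<noteq> 0"
    using rs unfolding root_system_def by auto
  have pair: "2 * (as ! i \<bullet> as ! j) = of_int (F4 ! i ! j) * (as ! j \<bullet> as ! j)"
    if "i < 4" "j < 4" for i j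
  proof -
    have "as ! j \<noteq> 0"
      using nz that(2) as_eq by (auto simp: less_Suc_eq numeral_eq_Suc)
    then show ?thesis using C[of i j] that unfolding len cartan_integer_def by (simp add: field_simps)
  qed
  define c where "c = (a4 \<bullet> a4) / 2"
  have "2 * (a1 \<bullet> a2) = - (a2 \<bullet> a2)" "2 * (a2 \<bullet> a1) = - (a1 \<bullet> a1)"
      "a1 \<bullet> a3 = 0" "a1 \<bullet> a4 = 0" "2 * (a2 \<bullet> a3) = - 2 * (a3 \<bullet> a3)" "2 * (a3 \<bullet> a2) = - (a2 \<bullet> a2)"
      "a2 \<bullet> a4 = 0" "2 * (a3 \<bullet> a4) = - (a4 \<bullet> a4)" "2 * (a4 \<bullet> a3) = - (a3 \<bullet> a3)"
    using pair[of 0 1] pair[of 1 0] pair[of 0 2] pair[of 0 3] pair[of 1 2] pair[of 2 1]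
      pair[of 1 3] pair[of 2 3] pair[of 3 2]
    by (simp_all add: as_eq F4_def)
  then have "F4_root_system \<Delta> P a1 a2 a3 a4 \<rho> c"
    using rs \<rho> simple nz by unfold_locales (auto simp: c_def inner_commute)
  then show ?thesis by blast
qed

theorem mainTheorem5:
  fixes \<Delta> P :: "'a::euclidean_space set"
  assumes "root_system \<Delta>"
    and "crystallographic \<Delta>"
    and "irreducible_roots \<Delta>"
    and "positive_system \<Delta> P"
    and "has_cartan_matrix P F4"
  shows "MC \<Delta> P = 6"
  using F4_root_system_exists[OF assms(1,4,5)] F4_root_system.MC_eq_6 by blast

end
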